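(* Let $d$, $m$ and $r$ be integers with $d \ge 3$, $m \ge r \ge 3$, $(r,d) \neq (3,3)$ and $(r,d)\neq (3,4)$. Let $G$ be an $r$-regular bipartite graph with $\lambda_c(G) \ge mr - \left\lceil \frac{r}{2} \right\rceil + 1$. If $M$ is a distance $d$ matching in $G$ with $|M| = m$, then $M$ extends to a perfect matching in $G$.
   Context: All graphs are finite and simple. A set $F$ of edges of a graph $G$ is a cyclic edge cut if $G-F$ has two components each of which contains a cycle. The cyclic edge-connectivity $\lambda_c(G)$ is the size of a minimum cyclic edge cut of $G$; if $G$ has no cyclic edge cut, $\lambda_c(G)=\infty$. The distance between two edges $e,f$ is the length of a shortest path joining an endvertex of $e$ and an endvertex of $f$. A matching $M$ is a distance $d$ matching if the distance between each pair of distinct edges of $M$ is at least $d$. A matching $M$ of $G$ extends to a perfect matching if there is a perfect matching $M^*$ of $G$ with $M \subseteq M^*$. *)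

theory Defs
  imports Complex_Main "HOL-Library.Extended_Nat"
begin

definition simple_graph :: "'a set \<Rightarrow> 'a set set \<Rightarrow> bool" where
  "simple_graph V E \<longleftrightarrow> finite V \<and> (\<forall>e\<in>E. e \<subseteq> V \<and> card e = 2)"

definition degree :: "'a set set \<Rightarrow> 'a \<Rightarrow> nat" where
  "degree E v = card {e \<in> E. v \<in> e}"

definition regular :: "nat \<Rightarrow> 'a set \<Rightarrow> 'a set set \<Rightarrow> bool" where
  "regular r V E \<longleftrightarrow> (\<forall>v\<in>V. degree E v = r)"

definition bipartite :: "'a set \<Rightarrow> 'a set set \<Rightarrow> bool" where
  "bipartite V E \<longleftrightarrow>
    (\<exists>A B. A \<union> B = V \<and> A \<inter> B = {} \<and> (\<forall>e\<in>E. \<exists>a\<in>A. \<exists>b\<in>B. e = {a, b}))"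

text \<open>A path is given by the list of its vertices, so its length, counted in edges, is
  \<open>length p - 1\<close>.\<close>

definition path :: "'a set \<Rightarrow> 'a set set \<Rightarrow> 'a list \<Rightarrow> bool" where
  "path V E p \<longleftrightarrow>
    p \<noteq> [] \<and> distinct p \<and> set p \<subseteq> V \<and> successively (\<lambda>u v. {u, v} \<in> E) p"

text \<open>A cycle is a path on at least three vertices whose ends are adjacent; the closing edge is
  left implicit.\<close>

definition cycle :: "'a set \<Rightarrow> 'a set set \<Rightarrow> 'a list \<Rightarrow> bool" where
  "cycle V E c \<longleftrightarrow> path V E c \<and> length c \<ge> 3 \<and> {last c, hd c} \<in> E"

text \<open>Components are represented by their vertex sets. The subgraph belonging to \<open>C\<close> is the one
  induced by \<open>C\<close>, so the cycles of the component are those with all vertices in \<open>C\<close>, that is,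
  those satisfying \<open>cycle C E\<close>.\<close>

definition components :: "'a set \<Rightarrow> 'a set set \<Rightarrow> 'a set set" where
  "components V E = V // {(u, v). \<exists>p. path V E p \<and> hd p = u \<and> last p = v}"

definition cyclic_edge_cut :: "'a set \<Rightarrow> 'a set set \<Rightarrow> 'a set set \<Rightarrow> bool" where
  "cyclic_edge_cut V E F \<longleftrightarrow> F \<subseteq> E \<and>
    (\<exists>C \<in> components V (E - F). \<exists>D \<in> components V (E - F).
      C \<noteq> D \<and> (\<exists>c. cycle C (E - F) c) \<and> (\<exists>c. cycle D (E - F) c))"

text \<open>In \<^typ>\<open>enat\<close> the infimum of the empty set is \<open>\<infinity>\<close>. This gives the value for graphs
  without a cyclic edge cut, and the distance of edges in different components.\<close>

definition cyclic_edge_connectivity :: "'a set \<Rightarrow> 'a set set \<Rightarrow> enat" where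
  "cyclic_edge_connectivity V E = (INF F \<in> {F. cyclic_edge_cut V E F}. enat (card F))"

definition edge_dist :: "'a set \<Rightarrow> 'a set set \<Rightarrow> 'a set \<Rightarrow> 'a set \<Rightarrow> enat" where
  "edge_dist V E e f =
    (INF p \<in> {p. path V E p \<and> hd p \<in> e \<and> last p \<in> f}. enat (length p - 1))"

definition matching :: "'a set set \<Rightarrow> 'a set set \<Rightarrow> bool" where
  "matching E M \<longleftrightarrow> M \<subseteq> E \<and> pairwise disjnt M"

definition perfect_matching :: "'a set \<Rightarrow> 'a set set \<Rightarrow> 'a set set \<Rightarrow> bool" where
  "perfect_matching V E M \<longleftrightarrow> matching E M \<and> \<Union>M = V"

definition distance_matching :: "nat \<Rightarrow> 'a set \<Rightarrow> 'a set set \<Rightarrow> 'a set set \<Rightarrow> bool" where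
  "distance_matching d V E M \<longleftrightarrow>
    matching E M \<and> pairwise (\<lambda>e f. enat d \<le> edge_dist V E e f) M"

definition extends_to_perfect_matching :: "'a set \<Rightarrow> 'a set set \<Rightarrow> 'a set set \<Rightarrow> bool" where
  "extends_to_perfect_matching V E M \<longleftrightarrow> (\<exists>M'. perfect_matching V E M' \<and> M \<subseteq> M')"

end

theory Submission
  imports Defs
begin

text \<open>If \<open>M\<close> does not extend, Hall's theorem gives a set \<open>X\<close> on one side \<open>A\<close> of the graph without
  \<open>V(M)\<close> whose neighbourhood \<open>Y\<close> there is smaller than \<open>X\<close>. Put all \<open>M\<close>-covered vertices of the other
  side \<open>B\<close> together with \<open>X \<union> Y\<close>. No vertex of \<open>X\<close> has a neighbour outside this set, so by regularity
  its boundary has \<open>r (|Y| + m - |X|) \<le> m r - r\<close> edges. Since edges of \<open>M\<close> have distance at least 3,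
  a vertex of \<open>X\<close> has at most one \<open>M\<close>-covered neighbour, hence at least two in \<open>Y\<close>; as
  \<open>|Y| < |X|\<close>, there is a cycle in \<open>X \<union> Y\<close>. The complement has the same structure with \<open>A\<close> and
  \<open>B\<close> exchanged, so it contains a cycle as well, and the boundary is a cyclic edge cut that is too
  small.\<close>

section \<open>Hall's theorem\<close>

text \<open>Halmos--Vaughan: either some proper nonempty \<open>J\<close> is tight, and then \<open>J\<close> and its complement
  (with the neighbours of \<open>J\<close> deleted) are matched separately, or any one element may be matched
  arbitrarily.\<close>

theorem hall:
  assumes "finite I" and "\<And>i. i \<in> I \<Longrightarrow> finite (N i)"
    and "\<And>J. J \<subseteq> I \<Longrightarrow> card J \<le> card (\<Union>(N ` J))"
  shows "\<exists>f. inj_on f I \<and> (\<forall>i\<in>I. f i \<in> N i)"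
  using assms
proof (induction "card I" arbitrary: I N rule: less_induct)
  case less
  note fin = less.prems(1) and finN = less.prems(2) and hall = less.prems(3)
  show ?case
  proof (cases "\<exists>J. J \<subset> I \<and> J \<noteq> {} \<and> card J = card (\<Union>(N ` J))")
    case True
    then obtain J where J: "J \<subset> I" "J \<noteq> {}" "card J = card (\<Union>(N ` J))" by blast
    have finJ: "finite J" using J(1) fin finite_subset by blast
    have "card J < card I" using J(1) fin psubset_card_mono by blast
    then obtain f where f: "inj_on f J" "\<forall>i\<in>J. f i \<in> N i"
      using less.hyps[of J N] J(1) finJ finN hall by blast
    define U where "U = \<Union>(N ` J)"
    have finU: "finite U" unfolding U_def using finJ finN J(1) by blast
    have cardI: "card (I - J) < card I"
      using J(1,2) fin by (intro psubset_card_mono) auto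
    have "\<exists>g. inj_on g (I - J) \<and> (\<forall>i\<in>I - J. g i \<in> N i - U)"
    proof (rule less.hyps[OF cardI])
      fix K assume K: "K \<subseteq> I - J"
      have finK: "finite K" using K fin finite_subset by blast
      \<comment> \<open>Hall's condition for \<open>K \<union> J\<close>: the tight set
        \<open>J\<close> accounts for exactly \<open>card U\<close> neighbours, and subtracting
        these leaves the condition for \<open>K\<close> with \<open>U\<close> deleted.\<close>
      have "card K + card J = card (K \<union> J)"
        using K finJ finK by (subst card_Un_disjoint) auto
      also have "\<dots> \<le> card (\<Union>(N ` (K \<union> J)))"
        using hall[of "K \<union> J"] K J(1) by blast
      also have "\<Union>(N ` (K \<union> J)) = \<Union>((\<lambda>i. N i - U) ` K) \<union> U"
        unfolding U_def by auto
      also have "card \<dots> \<le> card (\<Union>((\<lambda>i. N i - U) ` K)) + card U"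
        by (rule card_Un_le)
      finally show "card K \<le> card (\<Union>((\<lambda>i. N i - U) ` K))"
        using J(3) unfolding U_def by simp
    qed (use fin finN in auto)
    then obtain g where g: "inj_on g (I - J)" "\<forall>i\<in>I - J. g i \<in> N i - U" by blast
    define h where "h i = (if i \<in> J then f i else g i)" for i
    have "inj_on h I"
    proof (rule inj_onI)
      fix i j assume ij: "i \<in> I" "j \<in> I" "h i = h j"
      \<comment> \<open>The values of \<open>f\<close> lie in \<open>U\<close> and those of
        \<open>g\<close> avoid it, so the two injections cannot collide.\<close>
      have "h k \<in> U \<longleftrightarrow> k \<in> J" if "k \<in> I" for k
        using f(2) g(2) that unfolding h_def U_def by auto
      then have "i \<in> J \<longleftrightarrow> j \<in> J" using ij by metis
      then show "i = j"
        using ij f(1) g(1) unfolding h_def by (cases "i \<in> J") (auto dest: inj_onD)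
    qed
    moreover have "\<forall>i\<in>I. h i \<in> N i"
      using f g unfolding h_def by auto
    ultimately show ?thesis by blast
  next
    case False
    have strict: "card J < card (\<Union>(N ` J))" if "J \<subset> I" "J \<noteq> {}" for J
      using False hall[of J] that by (metis le_neq_implies_less psubset_imp_subset)
    show ?thesis
    proof (cases "I = {}")
      case nonempty: False
      then obtain i where i: "i \<in> I" by blast
      have "card {i} \<le> card (\<Union>(N ` {i}))" using hall[of "{i}"] i by blast
      then obtain y where y: "y \<in> N i" by fastforce
      have cardI: "card (I - {i}) < card I"
        using i fin by (meson card_Diff1_less)
      have "\<exists>g. inj_on g (I - {i}) \<and> (\<forall>j\<in>I - {i}. g j \<in> N j - {y})"
      proof (rule less.hyps[OF cardI])
        fix K assume K: "K \<subseteq> I - {i}"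
        have eq: "\<Union>((\<lambda>j. N j - {y}) ` K) = \<Union>(N ` K) - {y}" by auto
        show "card K \<le> card (\<Union>((\<lambda>j. N j - {y}) ` K))"
        proof (cases "K = {}")
          case False
          \<comment> \<open>\<open>K\<close> misses \<open>i\<close>, so it is a proper subset and
            not tight; the slack of one pays for deleting \<open>y\<close>.\<close>
          have "card K < card (\<Union>(N ` K))" using strict[of K] K i False by blast
          moreover have "card (\<Union>(N ` K)) - 1 \<le> card (\<Union>(N ` K) - {y})"
            by (metis card.empty card_insert_disjoint diff_card_le_card_Diff empty_iff
                finite.emptyI finite_insert One_nat_def)
          ultimately show ?thesis unfolding eq by linarith
        qed simp
      qed (use fin finN in auto)
      then obtain g where g: "inj_on g (I - {i})" "\<forall>j\<in>I - {i}. g j \<in> N j - {y}" by blast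
      have "inj_on (g(i := y)) I"
        using g by (auto simp: inj_on_def)
      moreover have "\<forall>j\<in>I. (g(i := y)) j \<in> N j"
        using g y by auto
      ultimately show ?thesis by blast
    qed simp
  qed
qed

section \<open>Cycles and cyclic edge cuts\<close>

lemma path_take:
  assumes "path V E p" and "k > 0"
  shows "path V E (take k p)"
proof -
  have "successively P (take k xs)" if "successively P xs" for P and xs :: "'b list"
    using that by (metis append_take_drop_id successively_append_iff)
  then show ?thesis
    using assms set_take_subset[of k p] unfolding path_def by auto
qed

text \<open>Only the vertices of \<open>c\<close> tie it to its vertex set, so a cycle may pass to a
  larger graph and also down to its own component.\<close>

lemma cycle_mono:
  assumes "cycle W E c" and "E \<subseteq> E'" and "set c \<subseteq> W'"
  shows "cycle W' E' c"
proof -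
  have "successively (\<lambda>u v. {u, v} \<in> E') c"
    using assms(1,2) unfolding cycle_def path_def
    by (auto intro: successively_mono[of "\<lambda>u v. {u, v} \<in> E"])
  then show ?thesis using assms unfolding cycle_def path_def by auto
qed

text \<open>The first vertex of a longest path has all its neighbours on the path, and a neighbour other
  than the second vertex closes a cycle.\<close>

lemma cycle_if_min_degree_ge_2:
  assumes "finite W" and "W \<noteq> {}" and "\<And>e. e \<in> E \<Longrightarrow> e \<subseteq> W \<and> card e = 2"
    and deg: "\<And>v. v \<in> W \<Longrightarrow> degree E v \<ge> 2"
  shows "\<exists>c. cycle W E c"
proof -
  obtain w where "w \<in> W" using assms(2) by blast
  then have "path W E [w]" by (simp add: path_def)
  moreover have bound: "length p \<le> card W" if "path W E p" for p
    using that assms(1) unfolding path_def by (metis card_mono distinct_card)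
  ultimately obtain p where p: "path W E p" and max: "\<And>q. path W E q \<Longrightarrow> length q \<le> length p"
    using ex_has_greatest_nat[of "path W E" "[w]" length "Suc (card W)"]
    by (metis le_imp_less_Suc)
  from p obtain v ps where vps: "p = v # ps" unfolding path_def by (cases p) auto
  have vW: "v \<in> W" using p vps unfolding path_def by auto
  have on: "u \<in> set ps" if "{v, u} \<in> E" for u
  proof (rule ccontr)
    assume "u \<notin> set ps"
    moreover have "u \<noteq> v" "u \<in> W" using assms(3)[OF that] by auto
    ultimately have "path W E (u # p)"
      using p that unfolding vps path_def by (auto simp: insert_commute)
    from max[OF this] show False by simp
  qed
  \<comment> \<open>If \<open>ps\<close> is empty, \<open>hd ps\<close> is unspecified, but the
    right-hand side has one element in any case, so a degree of at least 2 refutes the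
    inclusion.\<close>
  have "\<not> {e \<in> E. v \<in> e} \<subseteq> {{v, hd ps}}"
  proof
    assume "{e \<in> E. v \<in> e} \<subseteq> {{v, hd ps}}"
    then have "card {e \<in> E. v \<in> e} \<le> card {{v, hd ps}}" by (intro card_mono) auto
    then show False using deg[OF vW] unfolding degree_def by simp
  qed
  then obtain e where e: "e \<in> E" "v \<in> e" "e \<noteq> {v, hd ps}" by blast
  then obtain u where u: "e = {v, u}"
    using assms(3)[of e] by (metis card_2_iff insertE insert_commute singletonD)
  then have "u \<in> set ps" using on e(1) by blast
  then obtain k where k: "k < length ps" "ps ! k = u" by (metis in_set_conv_nth)
  have "k \<noteq> 0" using k u e(3) by (metis hd_conv_nth length_greater_0_conv)
  \<comment> \<open>Position \<open>k\<close> of \<open>ps\<close> is position \<open>k + 1\<close>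
    of \<open>p\<close>, so the prefix of length \<open>k + 2\<close> ends in \<open>u\<close>; it
    has at least three vertices because \<open>k \<noteq> 0\<close>.\<close>
  define c where "c = take (k + 2) p"
  have "path W E c" unfolding c_def using p by (intro path_take) auto
  moreover have "length c \<ge> 3" using k \<open>k \<noteq> 0\<close> unfolding c_def vps by simp
  moreover have "last c = u" "hd c = v"
    using k unfolding c_def vps by (auto simp: last_conv_nth)
  ultimately have "cycle W E c" using e(1) u unfolding cycle_def by (simp add: insert_commute)
  then show ?thesis by blast
qed

text \<open>Deleting a vertex of degree at most 1 removes at most one edge and so preserves the
  inequality. The induction ends when all degrees are at least 2.\<close>

lemma cycle_if_card_edges_ge_card_vertices:
  assumes "finite W" and "W \<noteq> {}" and "\<And>e. e \<in> E \<Longrightarrow> e \<subseteq> W \<and> card e = 2"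
    and "card W \<le> card E"
  shows "\<exists>c. cycle W E c"
  using assms
proof (induction "card W" arbitrary: W E rule: less_induct)
  case less
  have finE: "finite E"
    using less.prems(1,3) by (meson PowI finite_Pow_iff finite_subset subsetI)
  show ?case
  proof (cases "\<forall>v\<in>W. degree E v \<ge> 2")
    case True
    then show ?thesis using less.prems by (intro cycle_if_min_degree_ge_2) auto
  next
    case False
    then obtain v where v: "v \<in> W" "degree E v \<le> 1" by force
    define E' where "E' = E - {e \<in> E. v \<in> e}"
    have "card E - 1 \<le> card E'"
      using v(2) diff_card_le_card_Diff[of "{e \<in> E. v \<in> e}" E] finE
      unfolding E'_def degree_def by simp
    moreover have cW: "card (W - {v}) = card W - 1" using v(1) less.prems(1) by simp
    ultimately have card': "card (W - {v}) \<le> card E'" using less.prems(4) by linarith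
    \<comment> \<open>The deletion never exhausts the graph: on a single vertex the inequality would
      force an edge inside a singleton.\<close>
    have ne: "W - {v} \<noteq> {}"
    proof
      assume "W - {v} = {}"
      then have W: "W = {v}" using v(1) by blast
      then have "E \<noteq> {}" using less.prems(4) by auto
      then obtain e where "e \<subseteq> {v}" "card e = 2" using less.prems(3) W by blast
      then show False by (auto simp: subset_singleton_iff)
    qed
    have "\<exists>c. cycle (W - {v}) E' c"
    proof (rule less.hyps)
      show "card (W - {v}) < card W" using v(1) less.prems(1) by (meson card_Diff1_less)
    qed (use less.prems ne card' in \<open>auto simp: E'_def\<close>)
    then obtain c where c: "cycle (W - {v}) E' c" by blast
    then have "set c \<subseteq> W" unfolding cycle_def path_def by blast
    then show ?thesis using cycle_mono[OF c] unfolding E'_def by blast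
  qed
qed

text \<open>The initial segments of \<open>c\<close> are paths from \<open>hd c\<close> to every
  vertex of the cycle. Components appear only as images of a vertex, so reachability is never shown
  to be an equivalence.\<close>

lemma cycle_in_component:
  assumes "cycle V E c"
  defines "C \<equiv> {(u, v). \<exists>p. path V E p \<and> hd p = u \<and> last p = v} `` {hd c}"
  shows "C \<in> components V E" and "cycle C E c"
proof -
  have path: "path V E c" using assms(1) unfolding cycle_def by blast
  then have "c \<noteq> []" and "hd c \<in> V" unfolding path_def by (auto dest: hd_in_set)
  then show "C \<in> components V E" unfolding C_def components_def by (intro quotientI)
  have "v \<in> C" if "v \<in> set c" for v
  proof -
    from that obtain k where k: "k < length c" "c ! k = v" by (metis in_set_conv_nth)
    have "path V E (take (Suc k) c)" using path by (intro path_take) auto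
    moreover have "hd (take (Suc k) c) = hd c" using \<open>c \<noteq> []\<close> by simp
    moreover have "last (take (Suc k) c) = v" using k by (simp add: take_Suc_conv_app_nth)
    ultimately show ?thesis unfolding C_def by blast
  qed
  then show "cycle C E c" using cycle_mono[OF assms(1)] by blast
qed

lemma path_stays:
  assumes "path V E p" and "hd p \<in> S" and "\<And>e. e \<in> E \<Longrightarrow> e \<subseteq> S \<or> e \<inter> S = {}"
  shows "set p \<subseteq> S"
proof -
  have "successively (\<lambda>u v. {u, v} \<in> E) p" using assms(1) unfolding path_def by blast
  then show ?thesis using assms(2)
  proof (induction p rule: induct_list012)
    case (3 x y zs)
    then have "{x, y} \<in> E" "x \<in> S" by auto
    then have "y \<in> S" using assms(3)[of "{x, y}"] by auto
    then show ?case using 3 by auto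
  qed auto
qed

text \<open>Once the edges between \<open>S\<close> and \<open>T\<close> are gone, no edge leaves
  either side, so the components of the two cycles lie on different sides. The sides themselves may
  be disconnected.\<close>

lemma cyclic_edge_cut_boundary:
  assumes "cycle S E c" and "cycle T E c'" and "S \<union> T = V" and "S \<inter> T = {}"
    and "\<And>e. e \<in> E \<Longrightarrow> e \<subseteq> V"
  shows "cyclic_edge_cut V E {e \<in> E. e \<inter> S \<noteq> {} \<and> e \<inter> T \<noteq> {}}"
proof -
  define F where "F = {e \<in> E. e \<inter> S \<noteq> {} \<and> e \<inter> T \<noteq> {}}"
  have closed: "e \<subseteq> S \<or> e \<inter> S = {}" "e \<subseteq> T \<or> e \<inter> T = {}" if "e \<in> E - F" for e
    using that assms(3-5) unfolding F_def by blast+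
  \<comment> \<open>A cycle inside one side uses no edge between \<open>S\<close> and
    \<open>T\<close>, so it survives the removal of \<open>F\<close>.\<close>
  have lift: "cycle V (E - F) d" if d: "cycle U E d" and U: "U = S \<or> U = T" for U d
  proof -
    have "{u, v} \<in> E - F" if "{u, v} \<in> E" "u \<in> U" "v \<in> U" for u v
      using that U assms(4) unfolding F_def by blast
    moreover have "last d \<in> U" "hd d \<in> U" "set d \<subseteq> U" "set d \<subseteq> V"
      using d U assms(3) unfolding cycle_def path_def by auto
    moreover have "successively (\<lambda>u v. {u, v} \<in> E - F) d"
      using d calculation unfolding cycle_def path_def
      by (intro successively_mono[of "\<lambda>u v. {u, v} \<in> E" d "\<lambda>u v. {u, v} \<in> E - F"]) blast+
    ultimately show ?thesis using d unfolding cycle_def path_def by blast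
  qed
  define R where "R = {(u, v). \<exists>p. path V (E - F) p \<and> hd p = u \<and> last p = v}"
  have stays: "R `` {u} \<subseteq> U" if u: "u \<in> U" and U: "U = S \<or> U = T" for u U
  proof
    fix v assume "v \<in> R `` {u}"
    then obtain p where p: "path V (E - F) p" "hd p = u" "last p = v" unfolding R_def by blast
    have "set p \<subseteq> U" using path_stays[OF p(1)] p(2) u U closed by blast
    moreover have "v \<in> set p" using p unfolding path_def by auto
    ultimately show "v \<in> U" by blast
  qed
  have "hd c \<in> S" "hd c' \<in> T"
    using assms(1,2) unfolding cycle_def path_def by (auto dest: hd_in_set)
  then have "R `` {hd c} \<subseteq> S" "R `` {hd c'} \<subseteq> T"
    using stays by blast+
  moreover have C: "R `` {hd c} \<in> components V (E - F)" "cycle (R `` {hd c}) (E - F) c"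
    using cycle_in_component[OF lift[OF assms(1)]] unfolding R_def by simp_all
  moreover have D: "R `` {hd c'} \<in> components V (E - F)" "cycle (R `` {hd c'}) (E - F) c'"
    using cycle_in_component[OF lift[OF assms(2)]] unfolding R_def by simp_all
  \<comment> \<open>Subsets of disjoint sets are distinct once one of them is nonempty.\<close>
  moreover have "R `` {hd c} \<noteq> {}"
    using C(2) unfolding cycle_def path_def by auto
  ultimately have "R `` {hd c} \<noteq> R `` {hd c'}" using assms(4) by blast
  then have "cyclic_edge_cut V E F"
    using C D unfolding cyclic_edge_cut_def F_def by blast
  then show ?thesis unfolding F_def .
qed

section \<open>Counting in bipartite graphs\<close>

text \<open>Unlike \<open>bipartite\<close>, this names the two sides. It is symmetric in them, so
  each one-sided count can be reused for the other side.\<close>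

definition bipartition :: "'a set \<Rightarrow> 'a set \<Rightarrow> 'a set set \<Rightarrow> bool" where
  "bipartition A B E \<longleftrightarrow> A \<inter> B = {} \<and> (\<forall>e\<in>E. \<exists>a\<in>A. \<exists>b\<in>B. e = {a, b})"

lemma bipartition_commute: "bipartition A B E \<longleftrightarrow> bipartition B A E"
proof -
  have "(\<exists>a\<in>A. \<exists>b\<in>B. e = {a, b}) \<longleftrightarrow> (\<exists>a\<in>B. \<exists>b\<in>A. e = {a, b})" for e
    by (metis insert_commute)
  then show ?thesis unfolding bipartition_def by (simp add: Int_commute)
qed

lemma bipartition_inter:
  assumes "bipartition A B E" and "e \<in> E"
  shows "card (e \<inter> A) = 1"
proof -
  from assms obtain a b where "a \<in> A" "b \<in> B" "e = {a, b}" "A \<inter> B = {}"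
    unfolding bipartition_def by blast
  then have "e \<inter> A = {a}" by blast
  then show ?thesis by simp
qed

lemma bipartition_same_side:
  assumes "bipartition A B E" and "e \<in> E" and "x \<in> e" "y \<in> e" and "x \<in> A" "y \<in> A"
  shows "x = y"
proof -
  obtain a where "e \<inter> A = {a}"
    using bipartition_inter[OF assms(1,2)] by (rule card_1_singletonE)
  then show ?thesis using assms(3-6) by (metis IntI singletonD)
qed

text \<open>The edges of \<open>M\<close> are disjoint and each has exactly one end in
  \<open>A\<close>. Applied to both sides, this shows that \<open>M\<close> covers equally many
  vertices of each.\<close>

lemma card_matching_cover:
  assumes "bipartition A B E" and "matching E M" and "finite M"
  shows "card (A \<inter> \<Union>M) = card M"
proof -
  have sub: "M \<subseteq> E" and dis: "pairwise disjnt M" using assms(2) unfolding matching_def by auto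
  have one: "card (e \<inter> A) = 1" if "e \<in> M" for e
    using bipartition_inter[OF assms(1)] sub that by blast
  have "A \<inter> \<Union>M = (\<Union>e\<in>M. e \<inter> A)" by blast
  also have "card \<dots> = (\<Sum>e\<in>M. card (e \<inter> A))"
  proof (rule card_UN_disjoint)
    show "\<forall>e\<in>M. finite (e \<inter> A)" using one by (metis card.infinite zero_neq_one)
    show "\<forall>e\<in>M. \<forall>f\<in>M. e \<noteq> f \<longrightarrow> e \<inter> A \<inter> (f \<inter> A) = {}"
      using dis unfolding pairwise_def disjnt_def by blast
  qed (rule assms)
  also have "\<dots> = card M" using one by simp
  finally show ?thesis .
qed

text \<open>An edge has only one end in \<open>A\<close>, so no edge is counted at two vertices of
  \<open>Z\<close>. The predicate \<open>P\<close> serves to count only the edges inside a given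
  vertex set.\<close>

lemma card_edges_at:
  assumes "bipartition A B E" and "finite E" and "finite Z" and "Z \<subseteq> A"
  shows "card {e \<in> E. P e \<and> e \<inter> Z \<noteq> {}} = (\<Sum>z\<in>Z. card {e \<in> E. P e \<and> z \<in> e})"
proof -
  have "{e \<in> E. P e \<and> e \<inter> Z \<noteq> {}} = (\<Union>z\<in>Z. {e \<in> E. P e \<and> z \<in> e})" by blast
  also have "card \<dots> = (\<Sum>z\<in>Z. card {e \<in> E. P e \<and> z \<in> e})"
    using assms bipartition_same_side[OF assms(1)]
    by (intro card_UN_disjoint) fastforce+
  finally show ?thesis .
qed

lemma card_edges_at_regular:
  assumes "bipartition A B E" and "finite E" and "finite Z" and "Z \<subseteq> A"
    and "\<And>z. z \<in> Z \<Longrightarrow> degree E z = r"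
  shows "card {e \<in> E. e \<inter> Z \<noteq> {}} = r * card Z"
proof -
  have "card {e \<in> E. e \<inter> Z \<noteq> {}} = (\<Sum>z\<in>Z. degree E z)"
    using card_edges_at[OF assms(1-4), of "\<lambda>_. True"] by (simp add: degree_def)
  also have "\<dots> = (\<Sum>z\<in>Z. r)" using assms(5) by (intro sum.cong) auto
  finally show ?thesis by simp
qed

text \<open>Each vertex of \<open>X\<close> loses at most one edge to \<open>Q\<close>, so there are at least
  \<open>2 |X| \<ge> |X| + |Y|\<close> edges between \<open>X\<close> and \<open>Y\<close>.\<close>

lemma cycle_in_deficient_pair:
  assumes bip: "bipartition A B E" and fin: "finite E" "finite X" "finite Y"
    and sub: "X \<subseteq> A" "Y \<subseteq> B"
    and less: "card Y < card X"
    and deg: "\<And>x. x \<in> X \<Longrightarrow> degree E x \<ge> 3"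
    and nbr: "\<And>x y. x \<in> X \<Longrightarrow> {x, y} \<in> E \<Longrightarrow> y \<in> Y \<union> Q"
    and uniq: "\<And>x y z. x \<in> X \<Longrightarrow> {x, y} \<in> E \<Longrightarrow> {x, z} \<in> E \<Longrightarrow> y \<in> Q \<Longrightarrow> z \<in> Q \<Longrightarrow> y = z"
  shows "\<exists>c. cycle (X \<union> Y) E c"
proof -
  define D where "D = {e \<in> E. e \<subseteq> X \<union> Y}"
  have card2: "card e = 2" if e: "e \<in> E" for e
  proof -
    obtain a b where "a \<in> A" "b \<in> B" "e = {a, b}" "A \<inter> B = {}"
      using bip e unfolding bipartition_def by blast
    then show ?thesis by (metis card_2_iff disjoint_iff)
  qed
  have two: "2 \<le> card {e \<in> E. e \<subseteq> X \<union> Y \<and> x \<in> e}" if x: "x \<in> X" for x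
  proof -
    let ?out = "{e \<in> E. x \<in> e \<and> \<not> e \<subseteq> X \<union> Y}"
    have *: "\<exists>y\<in>Q. e = {x, y}" if e: "e \<in> ?out" for e
    proof -
      obtain p q where "e = {p, q}" using card2[of e] e by (auto simp: card_2_iff)
      then obtain y where "e = {x, y}" using e by blast
      then show ?thesis using e nbr[OF x] x by auto
    qed
    have "e = f" if "e \<in> ?out" "f \<in> ?out" for e f
      using *[OF that(1)] *[OF that(2)] uniq[OF x] that by blast
    then have "card ?out \<le> 1" using fin(1) by (simp add: card_le_Suc0_iff_eq)
    moreover have "{e \<in> E. x \<in> e} = {e \<in> E. e \<subseteq> X \<union> Y \<and> x \<in> e} \<union> ?out" by blast
    ultimately show ?thesis
      using deg[OF x] card_Un_le[of "{e \<in> E. e \<subseteq> X \<union> Y \<and> x \<in> e}" ?out]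
      unfolding degree_def by simp
  qed
  have "card (X \<union> Y) \<le> card X + card Y" by (rule card_Un_le)
  also have "\<dots> \<le> (\<Sum>x\<in>X. 2)" using less by simp
  also have "\<dots> \<le> (\<Sum>x\<in>X. card {e \<in> E. e \<subseteq> X \<union> Y \<and> x \<in> e})"
    using two by (intro sum_mono)
  also have "\<dots> = card {e \<in> E. e \<subseteq> X \<union> Y \<and> e \<inter> X \<noteq> {}}"
    using card_edges_at[OF bip fin(1,2) sub(1), of "\<lambda>e. e \<subseteq> X \<union> Y"] by simp
  also have "\<dots> \<le> card D" unfolding D_def using fin(1) by (intro card_mono) auto
  finally have "card (X \<union> Y) \<le> card D" .
  moreover have "X \<union> Y \<noteq> {}" using less by auto
  ultimately obtain c where c: "cycle (X \<union> Y) D c"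
    using cycle_if_card_edges_ge_card_vertices[of "X \<union> Y" D] fin card2 unfolding D_def by blast
  then have "set c \<subseteq> X \<union> Y" unfolding cycle_def path_def by blast
  then show ?thesis using cycle_mono[OF c] unfolding D_def by blast
qed

text \<open>All edges at \<open>X\<close> are edges at \<open>Z\<close>, and the boundary consists of the other edges at \<open>Z\<close>.\<close>

lemma card_boundary:
  assumes bip: "bipartition A B E" and fin: "finite E" "finite X" "finite Z"
    and sub: "X \<subseteq> A" "Z \<subseteq> B"
    and deg: "\<And>v. v \<in> X \<union> Z \<Longrightarrow> degree E v = r"
    and nbr: "\<And>x y. x \<in> X \<Longrightarrow> {x, y} \<in> E \<Longrightarrow> y \<in> Z"
    and T: "T \<inter> (X \<union> Z) = {}"
  shows "card {e \<in> E. e \<inter> (X \<union> Z) \<noteq> {} \<and> e \<inter> T \<noteq> {}} \<le> r * card Z - r * card X"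
proof -
  have edge: "\<exists>a\<in>A. \<exists>b\<in>B. e = {a, b}" if "e \<in> E" for e
    using that bip unfolding bipartition_def by blast
  have disj: "A \<inter> B = {}" using bip unfolding bipartition_def by blast
  have incl: "{e \<in> E. e \<inter> X \<noteq> {}} \<subseteq> {e \<in> E. e \<inter> Z \<noteq> {}}"
    and bd: "{e \<in> E. e \<inter> (X \<union> Z) \<noteq> {} \<and> e \<inter> T \<noteq> {}}
      \<subseteq> {e \<in> E. e \<inter> Z \<noteq> {}} - {e \<in> E. e \<inter> X \<noteq> {}}"
  proof -
    have key: "e \<subseteq> X \<union> Z \<and> e \<inter> Z \<noteq> {}" if e: "e \<in> E" "e \<inter> X \<noteq> {}" for e
    proof -
      obtain a b where ab: "a \<in> A" "b \<in> B" "e = {a, b}" using edge[OF e(1)] by blast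
      then have "a \<in> X" using e(2) sub(1) disj by blast
      moreover have "b \<in> Z" using nbr[of a b] \<open>a \<in> X\<close> e(1) ab(3) by blast
      ultimately show ?thesis using ab(3) by blast
    qed
    then show "{e \<in> E. e \<inter> X \<noteq> {}} \<subseteq> {e \<in> E. e \<inter> Z \<noteq> {}}" by blast
    show "{e \<in> E. e \<inter> (X \<union> Z) \<noteq> {} \<and> e \<inter> T \<noteq> {}}
      \<subseteq> {e \<in> E. e \<inter> Z \<noteq> {}} - {e \<in> E. e \<inter> X \<noteq> {}}"
      using key T by blast
  qed
  have "card {e \<in> E. e \<inter> (X \<union> Z) \<noteq> {} \<and> e \<inter> T \<noteq> {}}
      \<le> card ({e \<in> E. e \<inter> Z \<noteq> {}} - {e \<in> E. e \<inter> X \<noteq> {}})"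
    using bd fin(1) by (intro card_mono) auto
  also have "\<dots> = card {e \<in> E. e \<inter> Z \<noteq> {}} - card {e \<in> E. e \<inter> X \<noteq> {}}"
    using incl fin(1) by (intro card_Diff_subset) auto
  also have "\<dots> = r * card Z - r * card X"
    using card_edges_at_regular[OF bip fin(1,2) sub(1), of r] deg
      card_edges_at_regular[OF bip[unfolded bipartition_commute[of A]] fin(1,3) sub(2), of r]
    by simp
  finally show ?thesis .
qed

text \<open>If \<open>y\<close> and \<open>z\<close> were distinct, they would lie on different
  edges of \<open>M\<close>, being on the same side, and the path \<open>[y, x, z]\<close> would put
  these edges at distance at most 2.\<close>

lemma unique_neighbour_of_distance_matching:
  assumes bip: "bipartition A B E" and M: "distance_matching d V E M" and "3 \<le> d"
    and V: "\<And>e. e \<in> E \<Longrightarrow> e \<subseteq> V"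
    and e: "{x, y} \<in> E" "{x, z} \<in> E" and Q: "y \<in> B \<inter> \<Union>M" "z \<in> B \<inter> \<Union>M"
  shows "y = z"
proof (rule ccontr)
  assume ne: "y \<noteq> z"
  obtain f g where fg: "f \<in> M" "g \<in> M" "y \<in> f" "z \<in> g" using Q by blast
  have "M \<subseteq> E" using M unfolding distance_matching_def matching_def by blast
  then have "f \<noteq> g"
    using bipartition_same_side[OF bip[unfolded bipartition_commute[of A]], of f y z] fg ne Q by auto
  then have "enat d \<le> edge_dist V E f g"
    using M fg unfolding distance_matching_def pairwise_def by blast
  moreover have "edge_dist V E f g \<le> enat (length [y, x, z] - 1)"
    unfolding edge_dist_def
  proof (rule INF_lower)
    have "x \<noteq> y" "x \<noteq> z"
      using e Q bip unfolding bipartition_def by (metis disjoint_iff doubleton_eq_iff insert_absorb2)+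
    then show "[y, x, z] \<in> {p. path V E p \<and> hd p \<in> f \<and> last p \<in> g}"
      using e fg V[OF e(1)] V[OF e(2)] ne by (simp add: path_def insert_commute)
  qed
  ultimately have "enat d \<le> enat 2" by (metis One_nat_def diff_Suc_1 length_Cons list.size(3)
        numeral_2_eq_2 order_trans)
  then show False using \<open>3 \<le> d\<close> by simp
qed

section \<open>Extending the matching\<close>

text \<open>\<open>M\<close> covers equally many vertices on both sides, so the uncovered parts have
  the same size and the injection \<open>f\<close> between them is onto.\<close>

lemma perfect_matching_from_injection:
  assumes bip: "bipartition A B E" and M: "matching E M" and fin: "finite A" "finite B" "finite M"
    and card: "card A = card B"
    and inj: "inj_on f (A - \<Union>M)"
    and f: "\<And>a. a \<in> A - \<Union>M \<Longrightarrow> f a \<in> B - \<Union>M \<and> {a, f a} \<in> E"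
  shows "perfect_matching (A \<union> B) E (M \<union> (\<lambda>a. {a, f a}) ` (A - \<Union>M))"
proof -
  have M': "M \<subseteq> E" "\<And>e e'. e \<in> M \<Longrightarrow> e' \<in> M \<Longrightarrow> e \<noteq> e' \<Longrightarrow> e \<inter> e' = {}"
    using M unfolding matching_def pairwise_def disjnt_def by auto
  have disj: "A \<inter> B = {}" and edge: "\<And>e. e \<in> E \<Longrightarrow> e \<subseteq> A \<union> B"
    using bip unfolding bipartition_def by auto
  have "card (A - \<Union>M) = card (B - \<Union>M)"
    using card_matching_cover[OF bip M fin(3)] fin card
      card_matching_cover[OF bip[unfolded bipartition_commute[of A]] M fin(3)]
    by (simp add: card_Diff_subset_Int)
  then have surj: "f ` (A - \<Union>M) = B - \<Union>M"
    using f inj fin by (intro card_subset_eq) (auto simp: card_image)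
  have "pairwise disjnt (M \<union> (\<lambda>a. {a, f a}) ` (A - \<Union>M))"
  proof (rule pairwiseI)
    fix e e' assume "e \<in> M \<union> (\<lambda>a. {a, f a}) ` (A - \<Union>M)" "e' \<in> M \<union> (\<lambda>a. {a, f a}) ` (A - \<Union>M)"
      and ne: "e \<noteq> e'"
    then consider "e \<in> M" "e' \<in> M"
      | a where "e \<in> M" "a \<in> A - \<Union>M" "e' = {a, f a}"
      | a where "e' \<in> M" "a \<in> A - \<Union>M" "e = {a, f a}"
      | a a' where "a \<in> A - \<Union>M" "e = {a, f a}" "a' \<in> A - \<Union>M" "e' = {a', f a'}"
      by blast
    then show "disjnt e e'"
    proof cases
      case 4
      then have "a \<noteq> a'" "f a \<in> B" "f a' \<in> B" using ne f by auto
      moreover have "f a \<noteq> f a'" using inj 4 \<open>a \<noteq> a'\<close> by (meson inj_onD)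
      ultimately show ?thesis using 4 disj unfolding disjnt_def by blast
    qed (use f M'(2) ne in \<open>auto simp: disjnt_def\<close>)
  qed
  moreover have "\<Union>(M \<union> (\<lambda>a. {a, f a}) ` (A - \<Union>M)) = A \<union> B"
  proof -
    have "\<Union>(M \<union> (\<lambda>a. {a, f a}) ` (A - \<Union>M)) = \<Union>M \<union> (A - \<Union>M) \<union> f ` (A - \<Union>M)" by blast
    also have "\<dots> = A \<union> B" using surj edge M'(1) by blast
    finally show ?thesis .
  qed
  ultimately show ?thesis using M'(1) f unfolding perfect_matching_def matching_def by blast
qed

theorem corollary1:
  fixes d m r :: nat and V :: "'a set" and E M :: "'a set set"
  assumes "d \<ge> 3" and "m \<ge> r" and "r \<ge> 3"
    and "(r, d) \<noteq> (3, 3)" and "(r, d) \<noteq> (3, 4)"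
    and "simple_graph V E" and "regular r V E" and "bipartite V E"
    and "cyclic_edge_connectivity V E
           \<ge> enat (nat (int m * int r - \<lceil>real r / 2\<rceil> + 1))"
    and "distance_matching d V E M" and "card M = m"
  shows "extends_to_perfect_matching V E M"
proof -
  obtain A B where AB: "A \<union> B = V" and bip: "bipartition A B E"
    using assms(8) unfolding bipartite_def bipartition_def by blast
  note bip' = bip[unfolded bipartition_commute[of A]]
  have disj: "A \<inter> B = {}" using bip unfolding bipartition_def by blast
  have finV: "finite V" and EV: "\<And>e. e \<in> E \<Longrightarrow> e \<subseteq> V"
    using assms(6) unfolding simple_graph_def by auto
  have finE: "finite E" using finV EV by (meson PowI finite_Pow_iff finite_subset subsetI)
  have finAB: "finite A" "finite B" using finV AB by auto
  have deg: "\<And>v. v \<in> V \<Longrightarrow> degree E v = r" using assms(7) unfolding regular_def by blast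
  have M: "matching E M" using assms(10) unfolding distance_matching_def by blast
  then have finM: "finite M" using finE finite_subset unfolding matching_def by blast
  have cover: "card (A \<inter> \<Union>M) = m" "card (B \<inter> \<Union>M) = m"
    using card_matching_cover[OF bip M finM] card_matching_cover[OF bip' M finM] assms(11) by auto
  \<comment> \<open>Counting \<open>E\<close> from each side and cancelling \<open>r > 0\<close>
    shows that the sides are equally large.\<close>
  have "{e \<in> E. e \<inter> A \<noteq> {}} = E" "{e \<in> E. e \<inter> B \<noteq> {}} = E"
    using bip unfolding bipartition_def by auto
  then have "r * card A = r * card B"
    using card_edges_at_regular[OF bip finE finAB(1), of r]
      card_edges_at_regular[OF bip' finE finAB(2), of r] deg AB by fastforce
  then have cardAB: "card A = card B" using assms(3) by simp
  define N where "N a = {b \<in> B - \<Union>M. {a, b} \<in> E}" for a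
  have "card X \<le> card (\<Union>(N ` X))" if X: "X \<subseteq> A - \<Union>M" for X
  proof (rule ccontr)
    assume "\<not> card X \<le> card (\<Union>(N ` X))"
    then have less: "card (\<Union>(N ` X)) < card X" by simp
    define Y where "Y = \<Union>(N ` X)"
    \<comment> \<open>The mirror image with the sides exchanged: \<open>X'\<close> consists of the
      uncovered vertices of \<open>B\<close> without a neighbour in \<open>X\<close>. As the
      uncovered parts of \<open>A\<close> and \<open>B\<close> have equal size,
      \<open>card Y < card X\<close> turns into \<open>card Y' < card X'\<close>.\<close>
    define X' where "X' = B - \<Union>M - Y"
    define Y' where "Y' = A - \<Union>M - X"
    define Z where "Z = Y \<union> (B \<inter> \<Union>M)"
    define T where "T = X' \<union> (Y' \<union> (A \<inter> \<Union>M))"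
    have YB: "Y \<subseteq> B - \<Union>M" unfolding Y_def N_def by blast
    have fin: "finite X" "finite Y" "finite X'" "finite Y'"
      using X YB finAB finite_subset unfolding X'_def Y'_def by blast+
    have AM: "card (A - \<Union>M) = card A - m" "card (B - \<Union>M) = card B - m"
      using cover finAB by (auto simp: card_Diff_subset_Int)
    have less': "card Y' < card X'"
    proof -
      have "card Y' = card (A - \<Union>M) - card X" "card X' = card (B - \<Union>M) - card Y"
        unfolding X'_def Y'_def using X YB fin by (auto intro: card_Diff_subset)
      moreover have "card X \<le> card (A - \<Union>M)" using X finAB by (intro card_mono) auto
      ultimately show ?thesis using less AM cardAB unfolding Y_def by linarith
    qed
    have nbr: "y \<in> Y \<union> (B \<inter> \<Union>M)" if "x \<in> X" "{x, y} \<in> E" for x y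
    proof -
      have "y \<in> B"
        using that X bip unfolding bipartition_def by (metis DiffD1 disjoint_iff doubleton_eq_iff subsetD)
      then show ?thesis using that unfolding Y_def N_def by blast
    qed
    have nbr': "y \<in> Y' \<union> (A \<inter> \<Union>M)" if "x \<in> X'" "{x, y} \<in> E" for x y
    proof -
      have xB: "x \<in> B" "x \<notin> \<Union>M" "x \<notin> Y" using that unfolding X'_def by auto
      have "y \<in> A"
        using that(2) xB(1) bip unfolding bipartition_def by (metis disjoint_iff doubleton_eq_iff)
      \<comment> \<open>Here \<open>nbr\<close> is read backwards: an edge to \<open>X\<close> would
        put \<open>x\<close> into \<open>Y\<close> or among the covered vertices.\<close>
      moreover have "y \<notin> X" using that(2) nbr[of y x] xB by (auto simp: insert_commute)
      ultimately show ?thesis unfolding Y'_def by blast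
    qed
    have "\<exists>c. cycle (X \<union> Y) E c"
    proof (rule cycle_in_deficient_pair[OF bip finE fin(1,2), where Q = "B \<inter> \<Union>M"])
      show "degree E x \<ge> 3" if "x \<in> X" for x using deg[of x] that X AB assms(3) by auto
      show "y = z" if "{x, y} \<in> E" "{x, z} \<in> E" "y \<in> B \<inter> \<Union>M" "z \<in> B \<inter> \<Union>M" for x y z
        using unique_neighbour_of_distance_matching[OF bip assms(10,1) EV] that by blast
    qed (use X YB nbr less in \<open>auto simp: Y_def\<close>)
    then obtain c where c: "cycle (X \<union> Y) E c" by blast
    have "\<exists>c. cycle (X' \<union> Y') E c"
    proof (rule cycle_in_deficient_pair[OF bip' finE fin(3,4), where Q = "A \<inter> \<Union>M"])
      show "degree E x \<ge> 3" if "x \<in> X'" for x using deg[of x] that AB assms(3) X'_def by auto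
      show "y = z" if "{x, y} \<in> E" "{x, z} \<in> E" "y \<in> A \<inter> \<Union>M" "z \<in> A \<inter> \<Union>M" for x y z
        using unique_neighbour_of_distance_matching[OF bip' assms(10,1) EV] that by blast
    qed (use nbr' less' in \<open>auto simp: X'_def Y'_def\<close>)
    then obtain c' where c': "cycle (X' \<union> Y') E c'" by blast
    \<comment> \<open>Adding the covered vertices of \<open>B\<close> to the first pair and those of
      \<open>A\<close> to the second keeps both cycles and makes the two sets partition
      \<open>V\<close>.\<close>
    have cycles: "cycle (X \<union> Z) E c" "cycle T E c'"
      using cycle_mono[OF c] cycle_mono[OF c'] c c' unfolding cycle_def path_def Z_def T_def by blast+
    have ST: "(X \<union> Z) \<union> T = V" "(X \<union> Z) \<inter> T = {}"
      using X YB AB disj unfolding T_def Z_def X'_def Y'_def by blast+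
    have "cyclic_edge_cut V E {e \<in> E. e \<inter> (X \<union> Z) \<noteq> {} \<and> e \<inter> T \<noteq> {}}"
      by (rule cyclic_edge_cut_boundary[OF cycles ST EV])
    then have "cyclic_edge_connectivity V E
        \<le> enat (card {e \<in> E. e \<inter> (X \<union> Z) \<noteq> {} \<and> e \<inter> T \<noteq> {}})"
      unfolding cyclic_edge_connectivity_def by (intro INF_lower) simp
    from order_trans[OF assms(9) this] have "nat (int m * int r - \<lceil>real r / 2\<rceil> + 1)
        \<le> card {e \<in> E. e \<inter> (X \<union> Z) \<noteq> {} \<and> e \<inter> T \<noteq> {}}"
      by (simp only: enat_ord_simps)
    also have "\<dots> \<le> r * card Z - r * card X"
    proof (rule card_boundary[OF bip finE fin(1)])
      show "finite Z" "X \<subseteq> A" "Z \<subseteq> B" using X YB fin finAB unfolding Z_def by auto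
      then show "degree E v = r" if "v \<in> X \<union> Z" for v using deg that AB by blast
      show "y \<in> Z" if "x \<in> X" "{x, y} \<in> E" for x y using nbr that unfolding Z_def by blast
      show "T \<inter> (X \<union> Z) = {}" using ST(2) by blast
    qed
    also have "\<dots> = r * (card Z - card X)" by (simp add: diff_mult_distrib2)
    \<comment> \<open>\<open>Z\<close> has \<open>card Y + m\<close> elements and \<open>X\<close>
      has at least \<open>card Y + 1\<close>.\<close>
    also have "\<dots> \<le> r * (m - 1)"
    proof -
      have "card Z = card Y + m"
        unfolding Z_def using cover YB fin finAB by (subst card_Un_disjoint) auto
      then show ?thesis using less unfolding Y_def by (intro mult_le_mono2) linarith
    qed
    finally have "nat (int m * int r - \<lceil>real r / 2\<rceil> + 1) \<le> r * (m - 1)" .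
    then have "int m * int r - \<lceil>real r / 2\<rceil> + 1 \<le> int (r * (m - 1))" by linarith
    \<comment> \<open>The subtraction in \<open>m - 1\<close> is not truncated, since
      \<open>m \<ge> r \<ge> 3\<close>.\<close>
    also have "\<dots> = int m * int r - int r"
      using assms(2,3) by (simp add: algebra_simps)
    \<comment> \<open>The cut has at most \<open>m * r - r\<close> edges, which is below the assumed
      connectivity because half of \<open>r\<close>, rounded up, is at most
      \<open>r\<close>.\<close>
    finally have "int r + 1 \<le> \<lceil>real r / 2\<rceil>" by linarith
    moreover have "\<lceil>real r / 2\<rceil> \<le> int r" by (simp add: ceiling_le_iff)
    ultimately show False by linarith
  qed
  then obtain f where "inj_on f (A - \<Union>M)" "\<forall>a\<in>A - \<Union>M. f a \<in> N a"
    using hall[of "A - \<Union>M" N] finAB unfolding N_def by force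
  then have "perfect_matching (A \<union> B) E (M \<union> (\<lambda>a. {a, f a}) ` (A - \<Union>M))"
    using perfect_matching_from_injection[OF bip M finAB finM cardAB, of f] unfolding N_def by blast
  then show ?thesis unfolding extends_to_perfect_matching_def AB by blast
qed

end
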